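(* Let $\{x_k\}$ be the stationary AR($p$) process with parameter $\boldsymbol{\theta}\in\mathbb{R}^p$, $\|\boldsymbol{\theta}\|_1\le1-\eta<1$, and innovations of variance $\sigma_{\sf w}^2$, and let $\mathbf{X}$ be the $n\times p$ matrix of covariates, as in the context. Let $\mathbf{R}$ be the $p\times p$ covariance matrix of the process and suppose its singular values lie in $[\lambda_{\sf min},\lambda_{\sf max}]$ with $\lambda_{\sf min}>0$. Let $c_1,c_2,c_3$ be the positive constants of the autocorrelation concentration inequality recalled in the context. Let $m$ and $s$ be positive integers with $(m+1)s\le p$. Then $\mathbf{X}$ satisfies the restricted eigenvalue condition of order $(m+1)s$ with constant $\lambda_{\sf min}/2$ with probability at least $$1-c_1p^2(n+p)\exp\left(-\frac{c_4\sqrt{\frac ns}}{1+c_5\frac{n+p}{\left(\frac ns\right)^{3/2}}}\right),$$ where $$c_4=\frac{c_2}{\sigma_{\sf w}}\sqrt{\frac{\lambda_{\sf min}}{2(m+1)}},\qquad c_5=\frac{c_3\sigma_{\sf w}^3}{\left(\frac{\lambda_{\sf min}}{2(m+1)}\right)^{3/2}} .$$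
   Context: The AR($p$) process with parameter $\boldsymbol{\theta}=(\theta_1,\dots,\theta_p)$ is the stationary process $\{x_k\}_{k\in\mathbb{Z}}$ satisfying $x_k=\sum_{\ell=1}^p\theta_\ell x_{k-\ell}+w_k$, where $\{w_k\}_{k\in\mathbb{Z}}$ are i.i.d. zero-mean sub-Gaussian random variables with variance $\sigma_{\sf w}^2$. Its autocorrelation is $r_k=\mathbb{E}[x_ix_{i+k}]$, and $\mathbf{R}=(r_{|i-j|})_{i,j=1}^p$. The matrix of covariates $\mathbf{X}\in\mathbb{R}^{n\times p}$ is the Toeplitz matrix whose $i$-th row is $(x_{n-i},x_{n-i-1},\dots,x_{n-i-p+1})$, $i=1,\dots,n$. For an index set $S\subset\{1,\dots,p\}$, $\mathbf{X}_S$ is the submatrix of the columns of $\mathbf{X}$ indexed by $S$. For an integer $q$, $[\lambda_{\sf min}(q),\lambda_{\sf max}(q)]$ denotes the smallest interval containing the singular values of $\frac1n\mathbf{X}_S^T\mathbf{X}_S$ for all $S$ with $|S|=q$. $\mathbf{X}$ satisfies the restricted eigenvalue (RE) condition of order $q$ if $\lambda_{\sf min}(q)>0$; it satisfies it with constant $a>0$ if $\lambda_{\sf min}(q)\ge a$. Autocorrelation concentration inequality (a known result of Rudzkis for stationary linear processes, applied to the AR process): for $k=0,\dots,p-1$ let $\widehat r_k^{\,b}=\frac{1}{n+k}\sum_{i=1}^{n}x_ix_{i+k}$ and $r_k^b=\mathbb{E}[\widehat r_k^{\,b}]$. There are positive constants $c_1,c_2,c_3$, independent of the dimensions of the problem ($n,p,s,m$),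 such that for all $t>0$ and $0\le k\le p-1$, $$\mathbb{P}\left(|\widehat r_k^{\,b}-r_k^b|>t\right)\le c_1(n+k)\exp\left(-\frac{c_2}{\sigma_{\sf w}}\,\frac{t^2(n+k)}{c_3\sigma_{\sf w}^3+t^{3/2}\sqrt{n+k}}\right).$$ *)

theory Defs
  imports "HOL-Probability.Probability" "Jordan_Normal_Form.DL_Submatrix" "Jordan_Normal_Form.Char_Poly"
begin

(* Usual moment generating function form, for a centred variable. Integrability has to be demanded
   explicitly because the integral of a non-integrable function is 0. *)
definition sub_gaussian :: "'a measure \<Rightarrow> ('a \<Rightarrow> real) \<Rightarrow> bool" where
  "sub_gaussian M X \<longleftrightarrow>
     (\<exists>b>0. \<forall>u. integrable M (\<lambda>\<omega>. exp (u * X \<omega>)) \<and>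
        (\<integral>\<omega>. exp (u * X \<omega>) \<partial>M) \<le> exp (b\<^sup>2 * u\<^sup>2 / 2))"

definition wide_sense_stationary :: "'a measure \<Rightarrow> (int \<Rightarrow> 'a \<Rightarrow> real) \<Rightarrow> bool" where
  "wide_sense_stationary M x \<longleftrightarrow>
     (\<forall>k. x k \<in> borel_measurable M \<and> integrable M (\<lambda>\<omega>. (x k \<omega>)\<^sup>2)) \<and>
     (\<forall>j k. (\<integral>\<omega>. x j \<omega> \<partial>M) = (\<integral>\<omega>. x k \<omega> \<partial>M)) \<and>
     (\<forall>j k h. (\<integral>\<omega>. x (j + h) \<omega> * x (k + h) \<omega> \<partial>M) = (\<integral>\<omega>. x j \<omega> * x k \<omega> \<partial>M))"

(* Only the values \<theta> 1, ..., \<theta> p of the parameter matter. Stationarity is required in the wide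
   sense only: when the l1-norm of the parameter is below 1 the wide-sense stationary solution is
   the causal linear filter of the innovations, and is therefore strictly stationary as well. *)
locale ar_process = prob_space M for M :: "'a measure" +
  fixes p :: nat and \<theta> :: "nat \<Rightarrow> real" and \<sigma> :: real
    and w x :: "int \<Rightarrow> 'a \<Rightarrow> real"
  assumes innovations_indep: "indep_vars (\<lambda>_. borel) w UNIV"
    and innovations_ident: "\<And>j k. distr M borel (w j) = distr M borel (w k)"
    and innovations_mean: "\<And>k. expectation (w k) = 0"
    and innovations_sub_gaussian: "\<And>k. sub_gaussian M (w k)"
    and innovations_variance: "\<And>k. variance (w k) = \<sigma>\<^sup>2"
    and stationary: "wide_sense_stationary M x"
    and recursion: "\<And>k. AE \<omega> in M. x k \<omega> = (\<Sum>l=1..p. \<theta> l * x (k - int l) \<omega>) + w k \<omega>"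

(* The base point 0 is immaterial by stationarity. *)
definition autocorr :: "'a measure \<Rightarrow> (int \<Rightarrow> 'a \<Rightarrow> real) \<Rightarrow> int \<Rightarrow> real" where
  "autocorr M x k = (\<integral>\<omega>. x 0 \<omega> * x k \<omega> \<partial>M)"

definition covariance_mat :: "'a measure \<Rightarrow> (int \<Rightarrow> 'a \<Rightarrow> real) \<Rightarrow> nat \<Rightarrow> real mat" where
  "covariance_mat M x p = mat p p (\<lambda>(i, j). autocorr M x \<bar>int i - int j\<bar>)"

(* Matrix indices start at 0: with one-based row i and column j the entry is x (n - i - j + 1). *)
definition covariates :: "(int \<Rightarrow> 'a \<Rightarrow> real) \<Rightarrow> nat \<Rightarrow> nat \<Rightarrow> 'a \<Rightarrow> real mat" where
  "covariates x n p \<omega> = mat n p (\<lambda>(i, j). x (int n - int i - int j - 1) \<omega>)"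

definition singular_values :: "real mat \<Rightarrow> real set" where
  "singular_values A = {sqrt e | e. eigenvalue (transpose_mat A * A) e}"

definition gram_submatrix :: "real mat \<Rightarrow> nat set \<Rightarrow> real mat" where
  "gram_submatrix X S =
     (let XS = submatrix X UNIV S in (1 / real (dim_row X)) \<cdot>\<^sub>m (transpose_mat XS * XS))"

(* Lower end point of the smallest interval containing the singular values of all Gram
   submatrices of order q. *)
definition sparse_lambda_min :: "real mat \<Rightarrow> nat \<Rightarrow> real" where
  "sparse_lambda_min X q =
     Inf (\<Union>S\<in>{S. S \<subseteq> {..<dim_col X} \<and> card S = q}. singular_values (gram_submatrix X S))"

definition RE_condition :: "real mat \<Rightarrow> nat \<Rightarrow> real \<Rightarrow> bool" where
  "RE_condition X q a \<longleftrightarrow> 0 < a \<and> a \<le> sparse_lambda_min X q"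

definition biased_autocorr :: "(int \<Rightarrow> 'a \<Rightarrow> real) \<Rightarrow> nat \<Rightarrow> nat \<Rightarrow> 'a \<Rightarrow> real" where
  "biased_autocorr x n k \<omega> =
     (1 / real (n + k)) * (\<Sum>i=1..n. x (int i) \<omega> * x (int i + int k) \<omega>)"

(* The constants do not depend on the sample size n. *)
definition autocorr_concentration ::
  "'a measure \<Rightarrow> (int \<Rightarrow> 'a \<Rightarrow> real) \<Rightarrow> nat \<Rightarrow> real \<Rightarrow> real \<Rightarrow> real \<Rightarrow> real \<Rightarrow> bool" where
  "autocorr_concentration M x p \<sigma> c1 c2 c3 \<longleftrightarrow>
     (\<forall>n\<ge>1. \<forall>k<p. \<forall>t>0.
        measure M {\<omega> \<in> space M.
            \<bar>biased_autocorr x n k \<omega> - (\<integral>\<omega>'. biased_autocorr x n k \<omega>' \<partial>M)\<bar> > t}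
        \<le> c1 * real (n + k) *
           exp (- (c2 / \<sigma> * (t\<^sup>2 * real (n + k) /
                     (c3 * \<sigma> ^ 3 + t powr (3 / 2) * sqrt (real (n + k)))))))"

end

theory Submission
  imports Defs
begin

text \<open>If every entry of the Gram matrix is within \<open>\<epsilon> = lmin / (2 q)\<close> of the covariance, where
  \<open>q = (m + 1) s\<close>, then on a support of size \<open>q\<close> the two quadratic forms differ by at most
  \<open>\<epsilon> |u|\<^sub>1\<^sup>2 \<le> \<epsilon> q |u|\<^sub>2\<^sup>2 = (lmin / 2) |u|\<^sub>2\<^sup>2\<close>, so the union bound over the \<open>p\<^sup>2\<close> entries suffices. Each
  entry is a biased autocorrelation of a time shift of the process; since the concentration inequality
  only concerns the unshifted one, strict stationarity is needed. It holds because iterating the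
  recursion converges geometrically in mean, hence almost surely, so that the process is a
  shift-equivariant measurable function of the i.i.d. innovations.\<close>

subsection \<open>Smallest singular values of positive semidefinite matrices\<close>

no_notation inner (infix "\<bullet>" 70)

lemma scalar_prod_Cauchy_Schwarz:
  fixes u v :: "real vec"
  assumes "u \<in> carrier_vec n" "v \<in> carrier_vec n"
  shows "(u \<bullet> v)\<^sup>2 \<le> (u \<bullet> u) * (v \<bullet> v)"
  using assms Cauchy_Schwarz_ineq_sum[of "\<lambda>i. u $ i" "\<lambda>i. v $ i" "{0..<n}"]
  by (simp add: scalar_prod_def power2_eq_square)

lemma scalar_prod_self_nonneg: "0 \<le> v \<bullet> (v :: real vec)"
  by (simp add: scalar_prod_def sum_nonneg)

lemma scalar_prod_self_pos:
  fixes v :: "real vec"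
  assumes "v \<in> carrier_vec n" "v \<noteq> 0\<^sub>v n"
  shows "0 < v \<bullet> v"
proof -
  obtain i where "i < n" "v $ i \<noteq> 0"
    using assms by (metis carrier_vecD eq_vecI index_zero_vec)
  then show ?thesis
    using assms unfolding scalar_prod_def by (intro sum_pos2[where i = i]) auto
qed

lemma mult_mat_vec_bounded:
  fixes B :: "real mat"
  assumes B: "B \<in> carrier_mat m n"
  obtains K where "0 < K" "\<And>v. v \<in> carrier_vec n \<Longrightarrow> (B *\<^sub>v v) \<bullet> (B *\<^sub>v v) \<le> K * (v \<bullet> v)"
proof -
  \<comment> \<open>The squared Frobenius norm of \<open>B\<close>, plus 1 so that \<open>K\<close>
    stays positive when \<open>B\<close> is zero.\<close>
  define K where "K = (\<Sum>i<m. row B i \<bullet> row B i) + 1"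
  have "0 < K"
    unfolding K_def by (intro add_nonneg_pos sum_nonneg scalar_prod_self_nonneg) simp
  moreover have "(B *\<^sub>v v) \<bullet> (B *\<^sub>v v) \<le> K * (v \<bullet> v)" if v: "v \<in> carrier_vec n" for v
  proof -
    have "(B *\<^sub>v v) \<bullet> (B *\<^sub>v v) = (\<Sum>i<m. (row B i \<bullet> v)\<^sup>2)"
      using B by (auto simp: scalar_prod_def power2_eq_square lessThan_atLeast0 intro!: sum.cong)
    also have "\<dots> \<le> (\<Sum>i<m. (row B i \<bullet> row B i) * (v \<bullet> v))"
      by (intro sum_mono scalar_prod_Cauchy_Schwarz[of _ n]) (use B v in auto)
    also have "\<dots> \<le> K * (v \<bullet> v)"
      by (simp add: K_def distrib_right sum_distrib_right scalar_prod_self_nonneg)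
    finally show ?thesis .
  qed
  ultimately show ?thesis using that by blast
qed

lemma quadratic_form_bounded:
  fixes B :: "real mat"
  assumes B: "B \<in> carrier_mat n n"
  obtains L where "0 < L" "\<And>v. v \<in> carrier_vec n \<Longrightarrow> \<bar>v \<bullet> (B *\<^sub>v v)\<bar> \<le> L * (v \<bullet> v)"
proof -
  obtain K where K: "0 < K" "\<And>v. v \<in> carrier_vec n \<Longrightarrow> (B *\<^sub>v v) \<bullet> (B *\<^sub>v v) \<le> K * (v \<bullet> v)"
    using mult_mat_vec_bounded[OF B] by blast
  have "\<bar>v \<bullet> (B *\<^sub>v v)\<bar> \<le> sqrt K * (v \<bullet> v)" if v: "v \<in> carrier_vec n" for v
  proof -
    have "(v \<bullet> (B *\<^sub>v v))\<^sup>2 \<le> (v \<bullet> v) * ((B *\<^sub>v v) \<bullet> (B *\<^sub>v v))"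
      by (rule scalar_prod_Cauchy_Schwarz[of _ n]) (use B v in auto)
    also have "\<dots> \<le> (v \<bullet> v) * (K * (v \<bullet> v))"
      by (intro mult_left_mono K v scalar_prod_self_nonneg)
    also have "\<dots> = (sqrt K * (v \<bullet> v))\<^sup>2"
      using K(1) by (simp add: power_mult_distrib power2_eq_square)
    finally show ?thesis
      using K(1) scalar_prod_self_nonneg[of v] by (intro power2_le_imp_le[of "\<bar>_\<bar>"]) auto
  qed
  then show ?thesis using that[of "sqrt K"] K(1) by simp
qed

text \<open>Expanding the form at \<open>v - (1/L) B v\<close> gives \<open>L\<^sup>-\<^sup>1 |B v|\<^sup>2 \<le> v \<bullet> B v\<close>, which stands
  in for compactness of the unit sphere.\<close>
lemma psd_invertible_imp_coercive:
  fixes B :: "real mat"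
  assumes B: "B \<in> carrier_mat n n" and sym: "transpose_mat B = B"
    and psd: "\<And>v. v \<in> carrier_vec n \<Longrightarrow> 0 \<le> v \<bullet> (B *\<^sub>v v)"
    and det: "det B \<noteq> 0"
  obtains c where "0 < c" "\<And>v. v \<in> carrier_vec n \<Longrightarrow> c * (v \<bullet> v) \<le> v \<bullet> (B *\<^sub>v v)"
proof -
  obtain L where L: "0 < L" "\<And>v. v \<in> carrier_vec n \<Longrightarrow> \<bar>v \<bullet> (B *\<^sub>v v)\<bar> \<le> L * (v \<bullet> v)"
    using quadratic_form_bounded[OF B] by blast
  obtain C where C: "C \<in> carrier_mat n n" "C * B = 1\<^sub>m n"
    using det_non_zero_imp_unit[OF B det] by (auto simp: Units_def ring_mat_def)
  obtain K where K: "0 < K" "\<And>v. v \<in> carrier_vec n \<Longrightarrow> (C *\<^sub>v v) \<bullet> (C *\<^sub>v v) \<le> K * (v \<bullet> v)"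
    using mult_mat_vec_bounded[OF C(1)] by blast
  have "1 / (K * L) * (v \<bullet> v) \<le> v \<bullet> (B *\<^sub>v v)" if v: "v \<in> carrier_vec n" for v
  proof -
    define b where "b = B *\<^sub>v v"
    have b: "b \<in> carrier_vec n" using B v by (simp add: b_def)
    have Bb: "B *\<^sub>v b \<in> carrier_vec n" using B b by simp
    \<comment> \<open>Symmetry of \<open>B\<close> makes the two cross terms of the expansion below
      equal.\<close>
    have vBb: "v \<bullet> (B *\<^sub>v b) = b \<bullet> b"
      using transpose_vec_mult_scalar[OF B b v] sym by (simp add: b_def)
    define t where "t = - 1 / L"
    have "0 \<le> (v + t \<cdot>\<^sub>v b) \<bullet> (B *\<^sub>v (v + t \<cdot>\<^sub>v b))"
      using v b by (intro psd) auto
    also have "B *\<^sub>v (v + t \<cdot>\<^sub>v b) = b + t \<cdot>\<^sub>v (B *\<^sub>v b)"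
      using B v b by (simp add: mult_add_distrib_mat_vec mult_mat_vec b_def)
    also have "(v + t \<cdot>\<^sub>v b) \<bullet> (b + t \<cdot>\<^sub>v (B *\<^sub>v b)) =
        v \<bullet> b + 2 * t * (b \<bullet> b) + t\<^sup>2 * (b \<bullet> (B *\<^sub>v b))"
      using v b Bb vBb
      by (simp add: add_scalar_prod_distrib[of _ n] scalar_prod_add_distrib[of _ n]
          power2_eq_square algebra_simps)
    also have "\<dots> \<le> v \<bullet> b + 2 * t * (b \<bullet> b) + t\<^sup>2 * (L * (b \<bullet> b))"
      using L(2)[OF b] by (intro add_left_mono mult_left_mono) auto
    also have "\<dots> = v \<bullet> b - (b \<bullet> b) / L"
      using L(1) by (simp add: t_def field_simps power2_eq_square)
    finally have "(b \<bullet> b) / L \<le> v \<bullet> b" by simp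
    \<comment> \<open>Invertibility turns the lower bound in terms of \<open>b = B v\<close> into
      one in terms of \<open>v = C b\<close>.\<close>
    moreover have "C *\<^sub>v b = v"
      using C B v by (simp add: b_def flip: assoc_mult_mat_vec)
    then have "v \<bullet> v \<le> K * (b \<bullet> b)" using K(2)[OF b] by simp
    then have "1 / (K * L) * (v \<bullet> v) \<le> 1 / (K * L) * (K * (b \<bullet> b))"
      using K L by (intro mult_left_mono) auto
    ultimately show ?thesis using K L by (simp add: b_def)
  qed
  then show ?thesis using that[of "1 / (K * L)"] K(1) L(1) by simp
qed

text \<open>The minimum of the Rayleigh quotient is taken as the supremum \<mu> of its lower bounds.
  If \<open>A\<close> minus \<mu> times the identity were invertible, coercivity would allow a
  larger lower bound; so it is singular, and a kernel vector is an eigenvector for \<mu>.\<close>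

lemma symmetric_min_eigenvalue:
  fixes A :: "real mat"
  assumes A: "A \<in> carrier_mat n n" and sym: "transpose_mat A = A" and n: "1 \<le> n"
  obtains \<mu> where "eigenvalue A \<mu>" "\<And>v. v \<in> carrier_vec n \<Longrightarrow> \<mu> * (v \<bullet> v) \<le> v \<bullet> (A *\<^sub>v v)"
proof -
  define T where "T = {\<mu>. \<forall>v\<in>carrier_vec n. \<mu> * (v \<bullet> v) \<le> v \<bullet> (A *\<^sub>v v)}"
  obtain L where L: "0 < L" "\<And>v. v \<in> carrier_vec n \<Longrightarrow> \<bar>v \<bullet> (A *\<^sub>v v)\<bar> \<le> L * (v \<bullet> v)"
    using quadratic_form_bounded[OF A] by blast
  have "- L \<in> T"
    using L(2) by (force simp: T_def abs_le_iff)
  then have ne: "T \<noteq> {}" by blast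
  have bdd: "bdd_above T"
  proof
    \<comment> \<open>Any nonzero test vector bounds the set; the first unit vector exists because
      \<open>n\<close> is positive.\<close>
    fix \<mu> assume "\<mu> \<in> T"
    then have "\<mu> * (unit_vec n 0 \<bullet> unit_vec n 0) \<le> unit_vec n 0 \<bullet> (A *\<^sub>v unit_vec n 0)"
      by (simp add: T_def)
    then show "\<mu> \<le> unit_vec n 0 \<bullet> (A *\<^sub>v unit_vec n 0)" using n by simp
  qed
  define \<mu> where "\<mu> = Sup T"
  have min: "\<mu> * (v \<bullet> v) \<le> v \<bullet> (A *\<^sub>v v)" if v: "v \<in> carrier_vec n" for v
  proof (cases "v = 0\<^sub>v n")
    case True
    then show ?thesis using A by simp
  next
    case False
    then have pos: "0 < v \<bullet> v" using scalar_prod_self_pos[OF v] by simp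
    have "\<mu> \<le> (v \<bullet> (A *\<^sub>v v)) / (v \<bullet> v)"
      unfolding \<mu>_def using ne
    proof (rule cSup_least)
      fix y assume "y \<in> T"
      then show "y \<le> (v \<bullet> (A *\<^sub>v v)) / (v \<bullet> v)" using pos v by (simp add: T_def field_simps)
    qed
    then show ?thesis using pos by (simp add: field_simps)
  qed
  define B where "B = A + (- \<mu>) \<cdot>\<^sub>m 1\<^sub>m n"
  have B: "B \<in> carrier_mat n n" using A by (simp add: B_def)
  have Bv: "B *\<^sub>v v = A *\<^sub>v v + (- \<mu>) \<cdot>\<^sub>v v" if "v \<in> carrier_vec n" for v
  proof -
    have "((- \<mu>) \<cdot>\<^sub>m 1\<^sub>m n) *\<^sub>v v = (- \<mu>) \<cdot>\<^sub>v v"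
      using that by (intro eq_vecI) auto
    then show ?thesis
      using add_mult_distrib_mat_vec[OF A _ that, of "(- \<mu>) \<cdot>\<^sub>m 1\<^sub>m n"] by (simp add: B_def)
  qed
  have form: "v \<bullet> (B *\<^sub>v v) = v \<bullet> (A *\<^sub>v v) - \<mu> * (v \<bullet> v)" if "v \<in> carrier_vec n" for v
    using that A by (simp add: Bv scalar_prod_add_distrib[of _ n])
  have "det B = 0"
  proof (rule ccontr)
    assume det: "det B \<noteq> 0"
    have "transpose_mat B = B"
      using sym A by (auto simp: B_def transpose_add[of A n n] intro!: eq_matI)
    then obtain c where c: "0 < c" "\<And>v. v \<in> carrier_vec n \<Longrightarrow> c * (v \<bullet> v) \<le> v \<bullet> (B *\<^sub>v v)"
      using psd_invertible_imp_coercive[OF B _ _ det] min form by (metis diff_ge_0_iff_ge)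
    then have "\<mu> + c \<in> T"
      using form by (force simp: T_def algebra_simps)
    then have "\<mu> + c \<le> \<mu>" unfolding \<mu>_def using bdd by (rule cSup_upper)
    then show False using c(1) by simp
  qed
  then obtain v where v: "v \<in> carrier_vec n" "v \<noteq> 0\<^sub>v n" "B *\<^sub>v v = 0\<^sub>v n"
    using det_0_iff_vec_prod_zero[OF B] by blast
  have "A *\<^sub>v v = \<mu> \<cdot>\<^sub>v v"
  proof (rule eq_vecI)
    fix i assume "i < dim_vec (\<mu> \<cdot>\<^sub>v v)"
    then have i: "i < n" using v by simp
    have "(A *\<^sub>v v + (- \<mu>) \<cdot>\<^sub>v v) $ i = 0" using v(3) i by (simp add: Bv[OF v(1)])
    then show "(A *\<^sub>v v) $ i = (\<mu> \<cdot>\<^sub>v v) $ i" using i v(1) A by simp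
  qed (use A v in auto)
  then have "eigenvalue A \<mu>"
    using A v by (auto simp: eigenvalue_def eigenvector_def)
  then show ?thesis using that min by blast
qed

text \<open>Pair the eigenvector equation of the product with the eigenvector itself and move one
  factor \<open>B\<close> across.\<close>

lemma singular_value_sqr_norm:
  fixes B :: "real mat"
  assumes B: "B \<in> carrier_mat m n" and e: "eigenvalue (transpose_mat B * B) e"
  obtains v where "v \<in> carrier_vec n" "0 < v \<bullet> v" "(B *\<^sub>v v) \<bullet> (B *\<^sub>v v) = e * (v \<bullet> v)"
proof -
  obtain v where v: "v \<in> carrier_vec n" "v \<noteq> 0\<^sub>v n" "transpose_mat B * B *\<^sub>v v = e \<cdot>\<^sub>v v"
    using e B by (auto simp: eigenvalue_def eigenvector_def)
  have "(B *\<^sub>v v) \<bullet> (B *\<^sub>v v) = (transpose_mat B *\<^sub>v (B *\<^sub>v v)) \<bullet> v"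
    using transpose_vec_mult_scalar[OF B v(1), of "B *\<^sub>v v"] B v by simp
  also have "transpose_mat B *\<^sub>v (B *\<^sub>v v) = e \<cdot>\<^sub>v v"
    using assoc_mult_mat_vec[of "transpose_mat B" n m B n v] v B by simp
  also have "(e \<cdot>\<^sub>v v) \<bullet> v = e * (v \<bullet> v)"
    using v by simp
  finally show ?thesis using that v scalar_prod_self_pos by blast
qed

text \<open>\<open>sqrt\<close> is negative on negative reals, so the sign has to come from the
  eigenvalue, which is a quotient of squared norms.\<close>

lemma singular_values_nonneg:
  assumes "\<sigma> \<in> singular_values B"
  shows "0 \<le> \<sigma>"
proof -
  obtain e where e: "\<sigma> = sqrt e" "eigenvalue (transpose_mat B * B) e"
    using assms by (auto simp: singular_values_def)
  obtain v where "0 < v \<bullet> v" "(B *\<^sub>v v) \<bullet> (B *\<^sub>v v) = e * (v \<bullet> v)"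
    using singular_value_sqr_norm[OF carrier_matI[OF refl refl] e(2)] by blast
  then have "0 \<le> e" using scalar_prod_self_nonneg[of "B *\<^sub>v v"] by (simp add: zero_le_mult_iff)
  then show ?thesis using e by simp
qed

text \<open>The least eigenvalue \<mu> is nonnegative by semidefiniteness, and its eigenvector has
  eigenvalue \<open>\<mu>\<^sup>2\<close> for the squared matrix, so \<mu> is also a singular
  value.\<close>

lemma psd_min_singular_value:
  fixes B :: "real mat"
  assumes B: "B \<in> carrier_mat n n" and sym: "transpose_mat B = B" and n: "1 \<le> n"
    and psd: "\<And>v. v \<in> carrier_vec n \<Longrightarrow> 0 \<le> v \<bullet> (B *\<^sub>v v)"
  obtains \<mu> where "\<mu> \<in> singular_values B" "\<And>v. v \<in> carrier_vec n \<Longrightarrow> \<mu> * (v \<bullet> v) \<le> v \<bullet> (B *\<^sub>v v)"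
proof -
  obtain \<mu> where \<mu>: "eigenvalue B \<mu>" "\<And>v. v \<in> carrier_vec n \<Longrightarrow> \<mu> * (v \<bullet> v) \<le> v \<bullet> (B *\<^sub>v v)"
    using symmetric_min_eigenvalue[OF B sym n] by blast
  obtain v where v: "v \<in> carrier_vec n" "v \<noteq> 0\<^sub>v n" "B *\<^sub>v v = \<mu> \<cdot>\<^sub>v v"
    using \<mu>(1) B by (auto simp: eigenvalue_def eigenvector_def)
  have "0 \<le> \<mu> * (v \<bullet> v)" using psd[OF v(1)] v by simp
  then have "0 \<le> \<mu>" using scalar_prod_self_pos[OF v(1,2)] by (simp add: zero_le_mult_iff)
  have "transpose_mat B * B *\<^sub>v v = \<mu>\<^sup>2 \<cdot>\<^sub>v v"
    using B v by (simp add: sym assoc_mult_mat_vec[of _ n n _ n] mult_mat_vec smult_smult_assoc power2_eq_square)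
  then have "eigenvalue (transpose_mat B * B) (\<mu>\<^sup>2)"
    using B v by (auto simp: eigenvalue_def eigenvector_def)
  then have "\<mu> \<in> singular_values B"
    unfolding singular_values_def using \<open>0 \<le> \<mu>\<close> by (intro CollectI exI[of _ "\<mu>\<^sup>2"]) simp
  then show ?thesis using that \<mu>(2) by blast
qed

text \<open>Forwards, apply the hypothesis to the singular value that bounds the form from below.
  Backwards, Cauchy-Schwarz at an eigenvector \<open>v\<close> of \<open>transpose_mat B * B\<close>
  gives a |v|^2 \<le> v \<bullet> B v \<le> |v| |B v| = sqrt e |v|^2, so that \<open>v\<close> need
  not be an eigenvector of \<open>B\<close>.\<close>

lemma singular_values_ge_iff:
  fixes B :: "real mat"
  assumes B: "B \<in> carrier_mat n n" and sym: "transpose_mat B = B" and n: "1 \<le> n"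
    and psd: "\<And>v. v \<in> carrier_vec n \<Longrightarrow> 0 \<le> v \<bullet> (B *\<^sub>v v)" and a: "0 < a"
  shows "(\<forall>\<sigma>\<in>singular_values B. a \<le> \<sigma>) \<longleftrightarrow> (\<forall>v\<in>carrier_vec n. a * (v \<bullet> v) \<le> v \<bullet> (B *\<^sub>v v))"
    (is "?L \<longleftrightarrow> ?R")
proof
  assume ?L
  obtain \<mu> where \<mu>: "\<mu> \<in> singular_values B" "\<And>v. v \<in> carrier_vec n \<Longrightarrow> \<mu> * (v \<bullet> v) \<le> v \<bullet> (B *\<^sub>v v)"
    using psd_min_singular_value[OF B sym n psd] by blast
  with \<open>?L\<close> have "a * (v \<bullet> v) \<le> \<mu> * (v \<bullet> v)" for v
    by (intro mult_right_mono scalar_prod_self_nonneg) auto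
  with \<mu>(2) show ?R by (meson order_trans)
next
  assume R: ?R
  show ?L
  proof
    fix \<sigma> assume "\<sigma> \<in> singular_values B"
    then obtain e where e: "\<sigma> = sqrt e" "eigenvalue (transpose_mat B * B) e"
      by (auto simp: singular_values_def)
    obtain v where v: "v \<in> carrier_vec n" "0 < v \<bullet> v" "(B *\<^sub>v v) \<bullet> (B *\<^sub>v v) = e * (v \<bullet> v)"
      using singular_value_sqr_norm[OF B e(2)] by blast
    have "(a * (v \<bullet> v))\<^sup>2 \<le> (v \<bullet> (B *\<^sub>v v))\<^sup>2"
      using R v a by (intro power_mono) auto
    also have "\<dots> \<le> (v \<bullet> v) * ((B *\<^sub>v v) \<bullet> (B *\<^sub>v v))"
      by (rule scalar_prod_Cauchy_Schwarz[of _ n]) (use B v in auto)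
    finally have "a\<^sup>2 * (v \<bullet> v)\<^sup>2 \<le> e * (v \<bullet> v)\<^sup>2"
      using v(3) by (simp add: power_mult_distrib power2_eq_square mult_ac)
    then have "a\<^sup>2 \<le> e" using v(2) by simp
    then show "a \<le> \<sigma>" using e(1) a real_le_rsqrt by simp
  qed
qed

subsection \<open>The restricted eigenvalue condition as a quadratic form inequality\<close>

text \<open>The index set is arbitrary so that supports can vary without renumbering the
  coordinates, as submatrices would require.\<close>

definition quad_form :: "'i set \<Rightarrow> ('i \<Rightarrow> 'i \<Rightarrow> real) \<Rightarrow> ('i \<Rightarrow> real) \<Rightarrow> real" where
  "quad_form S g u = (\<Sum>i\<in>S. \<Sum>j\<in>S. u i * u j * g i j)"

lemma quad_form_reindex:
  assumes "bij_betw f T S"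
  shows "quad_form T (\<lambda>i j. g (f i) (f j)) (\<lambda>i. u (f i)) = quad_form S g u"
  unfolding quad_form_def
  by (simp add: sum.reindex_bij_betw[OF assms, of "\<lambda>i. \<Sum>j\<in>S. u i * u j * g i j", symmetric]
      sum.reindex_bij_betw[OF assms, of "\<lambda>j. u (f _) * u j * g (f _) j", symmetric])

lemma quad_form_smult:
  "quad_form S g (\<lambda>i. c * u i) = c\<^sup>2 * quad_form S g u"
  by (simp add: quad_form_def sum_distrib_left power2_eq_square mult_ac)

text \<open>Extension by zero: a bound on the form over the full index set passes to every
  support.\<close>

lemma quad_form_mono_neutral:
  assumes "finite T" "S \<subseteq> T"
  shows "quad_form T g (\<lambda>i. if i \<in> S then u i else 0) = quad_form S g u"
proof -
  have "quad_form T g (\<lambda>i. if i \<in> S then u i else 0) =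
      (\<Sum>i\<in>S. \<Sum>j\<in>T. u i * (if j \<in> S then u j else 0) * g i j)"
    unfolding quad_form_def using assms by (intro sum.mono_neutral_cong_right) auto
  also have "\<dots> = quad_form S g u"
    unfolding quad_form_def using assms by (intro sum.cong refl sum.mono_neutral_cong_right) auto
  finally show ?thesis .
qed

lemma tendsto_quad_form:
  assumes "\<And>i. i \<in> S \<Longrightarrow> ((\<lambda>n. f n i) \<longlongrightarrow> u i) F"
  shows "((\<lambda>n. quad_form S g (f n)) \<longlongrightarrow> quad_form S g u) F"
  unfolding quad_form_def by (intro tendsto_sum tendsto_mult assms tendsto_const)

lemma quad_form_perturb:
  assumes close: "\<And>i j. i \<in> S \<Longrightarrow> j \<in> S \<Longrightarrow> \<bar>g i j - r i j\<bar> \<le> \<epsilon>"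
    and lower: "l * (\<Sum>i\<in>S. (u i)\<^sup>2) \<le> quad_form S r u" and "0 \<le> \<epsilon>"
  shows "(l - \<epsilon> * real (card S)) * (\<Sum>i\<in>S. (u i)\<^sup>2) \<le> quad_form S g u"
proof -
  have "quad_form S r u - quad_form S g u = (\<Sum>i\<in>S. \<Sum>j\<in>S. u i * u j * (r i j - g i j))"
    by (simp add: quad_form_def sum_subtractf algebra_simps)
  also have "\<dots> \<le> (\<Sum>i\<in>S. \<Sum>j\<in>S. \<bar>u i\<bar> * \<bar>u j\<bar> * \<epsilon>)"
  proof (intro sum_mono)
    fix i j assume ij: "i \<in> S" "j \<in> S"
    have "u i * u j * (r i j - g i j) \<le> \<bar>u i\<bar> * \<bar>u j\<bar> * \<bar>g i j - r i j\<bar>"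
      by (metis abs_ge_self abs_minus_commute abs_mult)
    also have "\<dots> \<le> \<bar>u i\<bar> * \<bar>u j\<bar> * \<epsilon>"
      using close[OF ij] by (intro mult_left_mono) auto
    finally show "u i * u j * (r i j - g i j) \<le> \<bar>u i\<bar> * \<bar>u j\<bar> * \<epsilon>" .
  qed
  also have "\<dots> = \<epsilon> * (\<Sum>i\<in>S. \<bar>u i\<bar>)\<^sup>2"
    by (simp add: power2_eq_square sum_product sum_distrib_left mult_ac)
  \<comment> \<open>Cauchy-Schwarz trades the squared l1-norm for \<open>card S\<close> times the
    squared l2-norm.\<close>
  also have "\<dots> \<le> \<epsilon> * ((\<Sum>i\<in>S. \<bar>u i\<bar>\<^sup>2) * real (card S))"
    using \<open>0 \<le> \<epsilon>\<close> by (intro mult_left_mono sum_squared_le_sum_of_squares)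
  finally show ?thesis using lower by (simp add: algebra_simps)
qed

lemma scalar_prod_mult_mat_vec_eq_quad_form:
  fixes A :: "real mat"
  assumes "A \<in> carrier_mat n n" "v \<in> carrier_vec n"
  shows "v \<bullet> (A *\<^sub>v v) = quad_form {..<n} (\<lambda>i j. A $$ (i, j)) (\<lambda>i. v $ i)"
  using assms
  by (auto simp: quad_form_def scalar_prod_def lessThan_atLeast0 sum_distrib_left mult_ac intro!: sum.cong)

text \<open>The bijection \<open>f\<close> translates matrix positions into indices. It is the
  identity for the covariance matrix and \<open>pick S\<close> for a Gram submatrix.\<close>

lemma all_carrier_vec_quad_form_iff:
  fixes A :: "real mat"
  assumes A: "A \<in> carrier_mat n n" and f: "bij_betw f {..<n} S"
    and entry: "\<And>i j. i < n \<Longrightarrow> j < n \<Longrightarrow> A $$ (i, j) = g (f i) (f j)"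
  shows "(\<forall>v\<in>carrier_vec n. a * (v \<bullet> v) \<le> v \<bullet> (A *\<^sub>v v)) \<longleftrightarrow>
    (\<forall>u. a * (\<Sum>i\<in>S. (u i)\<^sup>2) \<le> quad_form S g u)"
proof -
  have eq: "(a * (v \<bullet> v) \<le> v \<bullet> (A *\<^sub>v v)) \<longleftrightarrow> (a * (\<Sum>i\<in>S. (u i)\<^sup>2) \<le> quad_form S g u)"
    if v: "v \<in> carrier_vec n" and u: "\<And>i. i < n \<Longrightarrow> v $ i = u (f i)" for u v
  proof -
    have "v \<bullet> v = (\<Sum>i<n. (u (f i))\<^sup>2)"
      using v u by (simp add: scalar_prod_def lessThan_atLeast0 power2_eq_square)
    also have "\<dots> = (\<Sum>i\<in>S. (u i)\<^sup>2)"
      by (rule sum.reindex_bij_betw[OF f])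
    finally have norm: "v \<bullet> v = (\<Sum>i\<in>S. (u i)\<^sup>2)" .
    have "v \<bullet> (A *\<^sub>v v) = quad_form {..<n} (\<lambda>i j. g (f i) (f j)) (\<lambda>i. u (f i))"
      unfolding scalar_prod_mult_mat_vec_eq_quad_form[OF A v] quad_form_def
      using entry u by (intro sum.cong) auto
    then show ?thesis by (simp add: quad_form_reindex[OF f] norm)
  qed
  show ?thesis
  proof (intro iffI allI ballI)
    fix u assume *: "\<forall>v\<in>carrier_vec n. a * (v \<bullet> v) \<le> v \<bullet> (A *\<^sub>v v)"
    show "a * (\<Sum>i\<in>S. (u i)\<^sup>2) \<le> quad_form S g u"
      using * eq[of "vec n (\<lambda>i. u (f i))" u] by simp
  next
    fix v :: "real vec"
    assume *: "\<forall>u. a * (\<Sum>i\<in>S. (u i)\<^sup>2) \<le> quad_form S g u" and v: "v \<in> carrier_vec n"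
    \<comment> \<open>Transport \<open>v\<close> back along \<open>f\<close>; values outside
      \<open>S\<close> are irrelevant.\<close>
    define u where "u k = v $ the_inv_into {..<n} f k" for k
    have "v $ i = u (f i)" if "i < n" for i
      using f that by (simp add: u_def the_inv_into_f_f bij_betw_def)
    with * show "a * (v \<bullet> v) \<le> v \<bullet> (A *\<^sub>v v)"
      by (simp add: eq[OF v])
  qed
qed

section \<open>Gram matrices of sets of columns\<close>

definition gram :: "real mat \<Rightarrow> nat \<Rightarrow> nat \<Rightarrow> real" where
  "gram X j k = (1 / real (dim_row X)) * (\<Sum>r<dim_row X. X $$ (r, j) * X $$ (r, k))"

text \<open>\<open>pick S\<close> lists \<open>S\<close> in increasing order, hence injectively, and
  counting then gives surjectivity.\<close>

lemma bij_betw_pick: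
  assumes "finite S"
  shows "bij_betw (pick S) {..<card S} S"
proof -
  have "inj_on (pick S) {..<card S}"
    by (rule inj_onI) (metis lessThan_iff linorder_neqE_nat nat_less_le pick_mono_le)
  moreover have "pick S ` {..<card S} = S"
    by (rule card_subset_eq) (use assms calculation in \<open>auto simp: card_image pick_in_set_le\<close>)
  ultimately show ?thesis by (simp add: bij_betw_def)
qed

context
  fixes X :: "real mat" and S :: "nat set"
  assumes S: "S \<subseteq> {..<dim_col X}"
begin

lemma submatrix_cols_carrier: "submatrix X UNIV S \<in> carrier_mat (dim_row X) (card S)"
proof -
  have "{j. j < dim_col X \<and> j \<in> S} = S" using S by auto
  then show ?thesis by (intro carrier_matI) (simp_all add: dim_submatrix)
qed

lemma gram_submatrix_carrier: "gram_submatrix X S \<in> carrier_mat (card S) (card S)"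
  using submatrix_cols_carrier by (simp add: gram_submatrix_def Let_def)

lemma gram_submatrix_index:
  assumes "i < card S" "j < card S"
  shows "gram_submatrix X S $$ (i, j) = gram X (pick S i) (pick S j)"
proof -
  have "{j. j < dim_col X \<and> j \<in> S} = S" using S by auto
  then have "submatrix X UNIV S $$ (r, i) = X $$ (r, pick S i)"
    if "r < dim_row X" "i < card S" for r i
    using that by (simp add: submatrix_index pick_UNIV)
  then show ?thesis
    using submatrix_cols_carrier assms
    by (simp add: gram_submatrix_def Let_def gram_def scalar_prod_def lessThan_atLeast0)
qed

lemma gram_submatrix_sym: "transpose_mat (gram_submatrix X S) = gram_submatrix X S"
  using gram_submatrix_carrier
  by (intro eq_matI) (auto simp: gram_submatrix_index gram_def mult.commute)

text \<open>The form is the mean over the rows \<open>r\<close> of the squared entries of the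
  submatrix applied to \<open>v\<close>. Without rows it is 0, since division by 0 yields 0.\<close>

lemma gram_submatrix_psd:
  assumes v: "v \<in> carrier_vec (card S)"
  shows "0 \<le> v \<bullet> (gram_submatrix X S *\<^sub>v v)"
proof -
  have "v \<bullet> (gram_submatrix X S *\<^sub>v v) =
      quad_form {..<card S} (\<lambda>i j. gram X (pick S i) (pick S j)) (\<lambda>i. v $ i)"
    unfolding scalar_prod_mult_mat_vec_eq_quad_form[OF gram_submatrix_carrier v] quad_form_def
    by (simp add: gram_submatrix_index)
  also have "\<dots> = (\<Sum>r<dim_row X. (\<Sum>i<card S. v $ i * X $$ (r, pick S i))\<^sup>2) / real (dim_row X)"
    unfolding quad_form_def gram_def power2_eq_square sum_product
    by (subst (2) sum.swap, subst (3) sum.swap, subst sum.swap)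
       (simp add: sum_distrib_left sum_divide_distrib mult_ac)
  also have "\<dots> \<ge> 0" by (intro divide_nonneg_nonneg sum_nonneg) auto
  finally show ?thesis .
qed

end

text \<open>The bounds on \<open>q\<close> ensure that some support exists and has a singular value.
  The infimum is then over a nonempty set bounded below by 0, so comparing it with \<open>a\<close>
  amounts to comparing each singular value, and semidefiniteness turns this into a form
  inequality.\<close>

lemma RE_condition_iff:
  assumes q: "1 \<le> q" "q \<le> dim_col X" and a: "0 < a"
  shows "RE_condition X q a \<longleftrightarrow>
    (\<forall>S. S \<subseteq> {..<dim_col X} \<and> card S = q \<longrightarrow> (\<forall>u. a * (\<Sum>i\<in>S. (u i)\<^sup>2) \<le> quad_form S (gram X) u))"
proof -
  define \<S> where "\<S> = {S. S \<subseteq> {..<dim_col X} \<and> card S = q}"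
  define T where "T = (\<Union>S\<in>\<S>. singular_values (gram_submatrix X S))"
  have "{..<q} \<in> \<S>" using q by (auto simp: \<S>_def)
  moreover have "singular_values (gram_submatrix X S) \<noteq> {}" if "S \<in> \<S>" for S
    using psd_min_singular_value[OF gram_submatrix_carrier gram_submatrix_sym _ gram_submatrix_psd] that q
    by (metis (mono_tags, lifting) \<S>_def empty_iff mem_Collect_eq)
  ultimately have "T \<noteq> {}" by (auto simp: T_def)
  moreover have "bdd_below T"
    by (rule bdd_belowI[of _ 0]) (auto simp: T_def intro: singular_values_nonneg)
  ultimately have "RE_condition X q a \<longleftrightarrow> (\<forall>t\<in>T. a \<le> t)"
    using a by (simp add: RE_condition_def sparse_lambda_min_def T_def \<S>_def le_cInf_iff)
  also have "\<dots> \<longleftrightarrow> (\<forall>S\<in>\<S>. \<forall>t\<in>singular_values (gram_submatrix X S). a \<le> t)"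
    by (auto simp: T_def)
  also have "\<dots> \<longleftrightarrow> (\<forall>S\<in>\<S>. \<forall>u. a * (\<Sum>i\<in>S. (u i)\<^sup>2) \<le> quad_form S (gram X) u)"
  proof (rule ball_cong[OF refl])
    fix S assume "S \<in> \<S>"
    then have S: "S \<subseteq> {..<dim_col X}" "1 \<le> card S" using q by (auto simp: \<S>_def)
    show "(\<forall>t\<in>singular_values (gram_submatrix X S). a \<le> t) \<longleftrightarrow>
        (\<forall>u. a * (\<Sum>i\<in>S. (u i)\<^sup>2) \<le> quad_form S (gram X) u)"
      using singular_values_ge_iff[OF gram_submatrix_carrier[OF S(1)] gram_submatrix_sym[OF S(1)]
          S(2) gram_submatrix_psd[OF S(1)] a]
        all_carrier_vec_quad_form_iff[OF gram_submatrix_carrier[OF S(1)]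
          bij_betw_pick[OF finite_subset[OF S(1)]] gram_submatrix_index[OF S(1)], of a]
      by simp
  qed
  finally show ?thesis by (auto simp: \<S>_def)
qed

section \<open>Measurability of the restricted eigenvalue event\<close>

lemma floor_mult_divide_tendsto:
  "(\<lambda>n. 1 / real (Suc n) * of_int \<lfloor>real (Suc n) * c\<rfloor>) \<longlonglongrightarrow> (c :: real)"
proof (rule real_tendsto_sandwich)
  show "\<forall>\<^sub>F n in sequentially. c - 1 / real (Suc n) \<le> 1 / real (Suc n) * of_int \<lfloor>real (Suc n) * c\<rfloor>"
  proof (intro always_eventually allI)
    fix n
    have "real (Suc n) * c - 1 \<le> of_int \<lfloor>real (Suc n) * c\<rfloor>" by linarith
    then have "1 / real (Suc n) * (real (Suc n) * c - 1) \<le> 1 / real (Suc n) * of_int \<lfloor>real (Suc n) * c\<rfloor>"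
      by (intro mult_left_mono) auto
    then show "c - 1 / real (Suc n) \<le> 1 / real (Suc n) * of_int \<lfloor>real (Suc n) * c\<rfloor>"
      by (simp add: right_diff_distrib del: of_nat_Suc)
  qed
  show "\<forall>\<^sub>F n in sequentially. 1 / real (Suc n) * of_int \<lfloor>real (Suc n) * c\<rfloor> \<le> c"
  proof (intro always_eventually allI)
    fix n
    have "of_int \<lfloor>real (Suc n) * c\<rfloor> \<le> real (Suc n) * c" by linarith
    then show "1 / real (Suc n) * of_int \<lfloor>real (Suc n) * c\<rfloor> \<le> c"
      by (simp add: field_simps del: of_nat_Suc)
  qed
  show "(\<lambda>n. c - 1 / real (Suc n)) \<longlonglongrightarrow> c"
    using tendsto_diff[OF tendsto_const lim_inverse_n'[THEN LIMSEQ_Suc]] by fastforce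
qed simp

text \<open>By homogeneity and continuity integer vectors suffice, which makes the condition a countable
  intersection.\<close>
lemma quad_form_ge_iff_int:
  assumes S: "S \<subseteq> {..<p}"
  shows "(\<forall>u. a * (\<Sum>i\<in>S. (u i)\<^sup>2) \<le> quad_form S g u) \<longleftrightarrow>
    (\<forall>zs :: int list. a * (\<Sum>i\<in>S. (of_int (zs ! i))\<^sup>2) \<le> quad_form S g (\<lambda>i. of_int (zs ! i)))"
    (is "?L \<longleftrightarrow> ?R")
proof
  assume R: ?R
  show ?L
  proof
    fix u :: "nat \<Rightarrow> real"
    \<comment> \<open>The denominator is common to all coordinates, so \<open>f n\<close> is a
      multiple of a single integer vector.\<close>
    define f where "f n i = 1 / real (Suc n) * of_int \<lfloor>real (Suc n) * u i\<rfloor>" for n i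
    have lim: "(\<lambda>n. f n i) \<longlonglongrightarrow> u i" for i
      unfolding f_def by (rule floor_mult_divide_tendsto)
    have le: "a * (\<Sum>i\<in>S. (f n i)\<^sup>2) \<le> quad_form S g (f n)" for n
    proof -
      \<comment> \<open>Integer vectors are encoded as lists because lists over a countable type are
        again countable, unlike functions on the naturals.\<close>
      define zs where "zs = map (\<lambda>i. \<lfloor>real (Suc n) * u i\<rfloor>) [0..<p]"
      define c where "c = 1 / real (Suc n)"
      have f: "f n i = c * of_int (zs ! i)" if "i \<in> S" for i
        using that S by (auto simp: f_def zs_def c_def)
      have "quad_form S g (f n) = quad_form S g (\<lambda>i. c * of_int (zs ! i))"
        unfolding quad_form_def by (intro sum.cong) (auto simp: f)
      also have "\<dots> = c\<^sup>2 * quad_form S g (\<lambda>i. of_int (zs ! i))" by (rule quad_form_smult)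
      also have "\<dots> \<ge> c\<^sup>2 * (a * (\<Sum>i\<in>S. (of_int (zs ! i))\<^sup>2))"
        using R by (intro mult_left_mono) auto
      also have "c\<^sup>2 * (a * (\<Sum>i\<in>S. (of_int (zs ! i))\<^sup>2)) = a * (\<Sum>i\<in>S. (f n i)\<^sup>2)"
        by (simp add: f power_mult_distrib sum_distrib_left mult_ac)
      finally show ?thesis .
    qed
    have "(\<lambda>n. a * (\<Sum>i\<in>S. (f n i)\<^sup>2)) \<longlonglongrightarrow> a * (\<Sum>i\<in>S. (u i)\<^sup>2)"
      by (intro tendsto_intros lim)
    moreover have "(\<lambda>n. quad_form S g (f n)) \<longlonglongrightarrow> quad_form S g u"
      by (intro tendsto_quad_form lim)
    ultimately show "a * (\<Sum>i\<in>S. (u i)\<^sup>2) \<le> quad_form S g u"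
      using le by (intro LIMSEQ_le) auto
  qed
qed simp

lemma borel_measurable_gram:
  assumes X: "\<And>\<omega>. X \<omega> \<in> carrier_mat n p"
    and meas: "\<And>i j. i < n \<Longrightarrow> j < p \<Longrightarrow> (\<lambda>\<omega>. X \<omega> $$ (i, j)) \<in> borel_measurable M"
    and "j < p" "k < p"
  shows "(\<lambda>\<omega>. gram (X \<omega>) j k) \<in> borel_measurable M"
  unfolding gram_def carrier_matD(1)[OF X] using assms(2-4)
  by (intro borel_measurable_times borel_measurable_const borel_measurable_sum) auto

text \<open>Passing to the complementary event in the union bound requires this. Finitely many
  supports and countably many integer vectors leave only comparisons of measurable
  functions.\<close>

lemma measurable_RE_condition:
  assumes X: "\<And>\<omega>. X \<omega> \<in> carrier_mat n p"
    and meas: "\<And>i j. i < n \<Longrightarrow> j < p \<Longrightarrow> (\<lambda>\<omega>. X \<omega> $$ (i, j)) \<in> borel_measurable M"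
    and q: "1 \<le> q" "q \<le> p" and a: "0 < a"
  shows "{\<omega> \<in> space M. RE_condition (X \<omega>) q a} \<in> sets M"
proof -
  note gram = borel_measurable_gram[OF X meas]
  have quad: "(\<lambda>\<omega>. quad_form S (gram (X \<omega>)) u) \<in> borel_measurable M" if "S \<subseteq> {..<p}" for S u
    unfolding quad_form_def using that by (intro borel_measurable_sum borel_measurable_times gram) auto
  have "RE_condition (X \<omega>) q a \<longleftrightarrow> (\<forall>S\<in>{S. S \<subseteq> {..<p} \<and> card S = q}.
      \<forall>zs :: int list. a * (\<Sum>i\<in>S. (of_int (zs ! i))\<^sup>2) \<le> quad_form S (gram (X \<omega>)) (\<lambda>i. of_int (zs ! i)))" for \<omega>
    unfolding RE_condition_iff[OF q(1) q(2)[folded carrier_matD(2)[OF X[of \<omega>]]] a] carrier_matD(2)[OF X]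
    using quad_form_ge_iff_int[where p = p] by auto
  then have "{\<omega> \<in> space M. RE_condition (X \<omega>) q a} = {\<omega> \<in> space M. \<forall>S\<in>{S. S \<subseteq> {..<p} \<and> card S = q}.
      \<forall>zs :: int list. a * (\<Sum>i\<in>S. (of_int (zs ! i))\<^sup>2) \<le> quad_form S (gram (X \<omega>)) (\<lambda>i. of_int (zs ! i))}"
    by simp
  also have "\<dots> \<in> sets M"
  proof (rule sets.sets_Collect_finite_All)
    show "finite {S. S \<subseteq> {..<p} \<and> card S = q}" by (rule finite_subset[of _ "Pow {..<p}"]) auto
    fix S assume "S \<in> {S. S \<subseteq> {..<p} \<and> card S = q}"
    then have S: "S \<subseteq> {..<p}" by simp
    show "{\<omega> \<in> space M. \<forall>zs :: int list.
        a * (\<Sum>i\<in>S. (of_int (zs ! i))\<^sup>2) \<le> quad_form S (gram (X \<omega>)) (\<lambda>i. of_int (zs ! i))} \<in> sets M"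
      by (intro sets.sets_Collect_countable_All borel_measurable_le borel_measurable_const quad S)
  qed
  finally show ?thesis .
qed

subsection \<open>Strict stationarity\<close>

text \<open>The recursion unrolled \<open>N\<close> times with the remaining past replaced by 0: a
  truncated causal moving average of the innovations whose coefficients never have to be written
  out.\<close>

primrec ar_filter :: "nat \<Rightarrow> (nat \<Rightarrow> real) \<Rightarrow> nat \<Rightarrow> int \<Rightarrow> (int \<Rightarrow> real) \<Rightarrow> real" where
  "ar_filter p \<theta> 0 k u = 0"
| "ar_filter p \<theta> (Suc N) k u = (\<Sum>l=1..p. \<theta> l * ar_filter p \<theta> N (k - int l) u) + u k"

lemma ar_filter_shift:
  "ar_filter p \<theta> N (k + h) u = ar_filter p \<theta> N k (\<lambda>j. u (j + h))"
proof (induction N arbitrary: k)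
  case (Suc N)
  have "ar_filter p \<theta> N (k + h - int l) u = ar_filter p \<theta> N (k - int l) (\<lambda>j. u (j + h))" for l
    using Suc[of "k - int l"] by (simp add: algebra_simps)
  then show ?case by simp
qed simp

lemma measurable_ar_filter [measurable]:
  "ar_filter p \<theta> N k \<in> borel_measurable (\<Pi>\<^sub>M j\<in>UNIV. borel)"
proof (induction N arbitrary: k)
  case (Suc N)
  have [measurable]: "(\<lambda>u. u k) \<in> borel_measurable (\<Pi>\<^sub>M j\<in>UNIV. borel :: real measure)"
    by (rule measurable_component_singleton) simp
  note Suc[measurable]
  show ?case by simp
next
  case 0
  have "ar_filter p \<theta> 0 k = (\<lambda>u. 0)" by (simp add: fun_eq_iff)
  then show ?case by simp
qed

text \<open>The means are summable, so the sum of the absolute values has finite mean. It is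
  therefore almost surely finite, and its terms tend to 0.\<close>

lemma (in prob_space) AE_tendsto_0_of_geometric:
  fixes D :: "nat \<Rightarrow> 'a \<Rightarrow> real"
  assumes int: "\<And>N. integrable M (D N)"
    and bound: "\<And>N. expectation (\<lambda>\<omega>. \<bar>D N \<omega>\<bar>) \<le> C * \<rho> ^ N"
    and \<rho>: "0 \<le> \<rho>" "\<rho> < 1"
  shows "AE \<omega> in M. (\<lambda>N. D N \<omega>) \<longlonglongrightarrow> 0"
proof -
  have [measurable]: "D N \<in> borel_measurable M" for N
    using int by (rule borel_measurable_integrable)
  have "0 \<le> expectation (\<lambda>\<omega>. \<bar>D 0 \<omega>\<bar>)" by (rule integral_nonneg_AE) simp
  also have "\<dots> \<le> C" using bound[of 0] by simp
  finally have "0 \<le> C" .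
  have "(\<integral>\<^sup>+\<omega>. (\<Sum>N. ennreal \<bar>D N \<omega>\<bar>) \<partial>M) = (\<Sum>N. \<integral>\<^sup>+\<omega>. ennreal \<bar>D N \<omega>\<bar> \<partial>M)"
    by (intro nn_integral_suminf) measurable
  also have "\<dots> = (\<Sum>N. ennreal (expectation (\<lambda>\<omega>. \<bar>D N \<omega>\<bar>)))"
    using int by (subst nn_integral_eq_integral) auto
  also have "\<dots> \<le> (\<Sum>N. ennreal (C * \<rho> ^ N))"
    using bound by (intro suminf_le ennreal_leI) auto
  also have "\<dots> < \<infinity>"
  proof -
    have "summable (\<lambda>N. C * \<rho> ^ N)" using \<rho> by (intro summable_mult summable_geometric) auto
    then show ?thesis using \<open>0 \<le> C\<close> \<rho> by (simp add: suminf_ennreal2)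
  qed
  finally have "AE \<omega> in M. (\<Sum>N. ennreal \<bar>D N \<omega>\<bar>) \<noteq> \<infinity>"
    by (intro nn_integral_PInf_AE) auto
  then show ?thesis
  proof eventually_elim
    case (elim \<omega>)
    then have "summable (\<lambda>N. \<bar>D N \<omega>\<bar>)" by (intro summable_suminf_not_top) auto
    then show ?case using summable_LIMSEQ_zero tendsto_rabs_zero_iff by blast
  qed
qed

section \<open>The process as an almost sure limit of filters of its innovations\<close>

context ar_process
begin

lemma borel_measurable_x [measurable]: "x k \<in> borel_measurable M"
  using stationary by (simp add: wide_sense_stationary_def)

lemma borel_measurable_w [measurable]: "w k \<in> borel_measurable M"
  using innovations_indep by (simp add: indep_vars_def)

lemma borel_measurable_ar_filter_w [measurable]:
  "(\<lambda>\<omega>. ar_filter p \<theta> N k (\<lambda>j. w j \<omega>)) \<in> borel_measurable M"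
proof -
  have "(\<lambda>\<omega> j. w j \<omega>) \<in> measurable M (\<Pi>\<^sub>M j\<in>UNIV. borel)"
    by (rule measurable_PiM_single') auto
  from measurable_compose[OF this measurable_ar_filter] show ?thesis .
qed

lemma integrable_x_mult_x: "integrable M (\<lambda>\<omega>. x j \<omega> * x k \<omega>)"
proof (rule Bochner_Integration.integrable_bound)
  show "integrable M (\<lambda>\<omega>. (x j \<omega>)\<^sup>2 + (x k \<omega>)\<^sup>2)"
    using stationary by (simp add: wide_sense_stationary_def)
  show "AE \<omega> in M. norm (x j \<omega> * x k \<omega>) \<le> norm ((x j \<omega>)\<^sup>2 + (x k \<omega>)\<^sup>2)"
  proof (rule AE_I2)
    fix \<omega>
    have "2 * \<bar>x j \<omega>\<bar> * \<bar>x k \<omega>\<bar> \<le> (x j \<omega>)\<^sup>2 + (x k \<omega>)\<^sup>2"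
      using sum_squares_bound[of "\<bar>x j \<omega>\<bar>" "\<bar>x k \<omega>\<bar>"] by simp
    moreover have "0 \<le> \<bar>x j \<omega>\<bar> * \<bar>x k \<omega>\<bar>" by simp
    ultimately have "\<bar>x j \<omega>\<bar> * \<bar>x k \<omega>\<bar> \<le> (x j \<omega>)\<^sup>2 + (x k \<omega>)\<^sup>2" by linarith
    then show "norm (x j \<omega> * x k \<omega>) \<le> norm ((x j \<omega>)\<^sup>2 + (x k \<omega>)\<^sup>2)"
      by (simp add: abs_mult)
  qed
qed measurable

text \<open>Shifting the smaller of the two indices to 0 leaves a nonnegative lag.\<close>

lemma expectation_x_mult_x: "expectation (\<lambda>\<omega>. x j \<omega> * x k \<omega>) = autocorr M x \<bar>j - k\<bar>"
proof -
  have shift: "expectation (\<lambda>\<omega>. x (j + h) \<omega> * x (k + h) \<omega>) = expectation (\<lambda>\<omega>. x j \<omega> * x k \<omega>)" for j k h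
    using stationary by (simp add: wide_sense_stationary_def)
  show ?thesis
    using shift[of 0 j "k - j"] shift[of 0 k "j - k"]
    by (cases "j \<le> k") (simp_all add: autocorr_def mult.commute)
qed

text \<open>The innovation cancels in the error, which thus obeys the homogeneous recursion. Each
  unrolling multiplies a bound on the mean error, uniform in \<open>k\<close>, by the l1-norm of the
  parameter.\<close>

lemma ar_filter_L1_error:
  obtains C where "\<And>N k. integrable M (\<lambda>\<omega>. x k \<omega> - ar_filter p \<theta> N k (\<lambda>j. w j \<omega>))"
    "\<And>N k. expectation (\<lambda>\<omega>. \<bar>x k \<omega> - ar_filter p \<theta> N k (\<lambda>j. w j \<omega>)\<bar>) \<le> C * (\<Sum>l=1..p. \<bar>\<theta> l\<bar>) ^ N"
proof -
  define D where "D N k \<omega> = x k \<omega> - ar_filter p \<theta> N k (\<lambda>j. w j \<omega>)" for N k \<omega>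
  have [measurable]: "D N k \<in> borel_measurable M" for N k
    unfolding D_def by measurable
  \<comment> \<open>For \<open>N = 0\<close> the error is \<open>x k\<close> itself, and
    \<bar>y\<bar> \<le> 1 + y^2 bounds its mean by this constant, which stationarity makes
    independent of \<open>k\<close>.\<close>
  define C where "C = 1 + autocorr M x 0"
  have sq: "integrable M (\<lambda>\<omega>. (x k \<omega>)\<^sup>2)" for k
    using stationary by (simp add: wide_sense_stationary_def)
  have le: "\<bar>y\<bar> \<le> 1 + y\<^sup>2" for y :: real
  proof -
    have "0 \<le> (\<bar>y\<bar> - 1)\<^sup>2" by simp
    then show ?thesis by (simp add: power2_diff)
  qed
  have "integrable M (D N k) \<and> expectation (\<lambda>\<omega>. \<bar>D N k \<omega>\<bar>) \<le> C * (\<Sum>l=1..p. \<bar>\<theta> l\<bar>) ^ N" for N k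
  proof (induction N arbitrary: k)
    case 0
    have "integrable M (x k)"
      by (rule Bochner_Integration.integrable_bound[of _ "\<lambda>\<omega>. 1 + (x k \<omega>)\<^sup>2"]) (use sq le in auto)
    moreover from this have "expectation (\<lambda>\<omega>. \<bar>x k \<omega>\<bar>) \<le> expectation (\<lambda>\<omega>. 1 + (x k \<omega>)\<^sup>2)"
      using sq le by (intro integral_mono) auto
    moreover have "\<dots> = C"
      using sq expectation_x_mult_x[of k k] by (simp add: C_def power2_eq_square prob_space)
    ultimately show ?case by (simp add: D_def)
  next
    case (Suc N)
    have eq: "AE \<omega> in M. D (Suc N) k \<omega> = (\<Sum>l=1..p. \<theta> l * D N (k - int l) \<omega>)"
      using recursion[of k]
      by eventually_elim (simp add: D_def right_diff_distrib sum_subtractf)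
    have int: "integrable M (\<lambda>\<omega>. \<Sum>l=1..p. \<theta> l * D N (k - int l) \<omega>)"
      using Suc by (intro Bochner_Integration.integrable_sum integrable_mult_right) auto
    have "expectation (\<lambda>\<omega>. \<bar>D (Suc N) k \<omega>\<bar>) = expectation (\<lambda>\<omega>. \<bar>\<Sum>l=1..p. \<theta> l * D N (k - int l) \<omega>\<bar>)"
      by (rule integral_cong_AE) (use eq in auto)
    also have "\<dots> \<le> expectation (\<lambda>\<omega>. \<Sum>l=1..p. \<bar>\<theta> l\<bar> * \<bar>D N (k - int l) \<omega>\<bar>)"
    proof (rule integral_mono)
      show "integrable M (\<lambda>\<omega>. \<Sum>l=1..p. \<bar>\<theta> l\<bar> * \<bar>D N (k - int l) \<omega>\<bar>)"
        using Suc by (intro Bochner_Integration.integrable_sum integrable_mult_right integrable_abs) auto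
      show "\<bar>\<Sum>l=1..p. \<theta> l * D N (k - int l) \<omega>\<bar> \<le> (\<Sum>l=1..p. \<bar>\<theta> l\<bar> * \<bar>D N (k - int l) \<omega>\<bar>)" for \<omega>
        by (rule order_trans[OF sum_abs]) (simp add: abs_mult)
    qed (use int in auto)
    also have "\<dots> = (\<Sum>l=1..p. \<bar>\<theta> l\<bar> * expectation (\<lambda>\<omega>. \<bar>D N (k - int l) \<omega>\<bar>))"
      using Suc by (subst Bochner_Integration.integral_sum) (auto intro!: integrable_mult_right integrable_abs)
    also have "\<dots> \<le> (\<Sum>l=1..p. \<bar>\<theta> l\<bar> * (C * (\<Sum>l=1..p. \<bar>\<theta> l\<bar>) ^ N))"
      using Suc by (intro sum_mono mult_left_mono) auto
    also have "\<dots> = C * (\<Sum>l=1..p. \<bar>\<theta> l\<bar>) ^ Suc N"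
      by (simp flip: sum_distrib_right)
    finally have "expectation (\<lambda>\<omega>. \<bar>D (Suc N) k \<omega>\<bar>) \<le> C * (\<Sum>l=1..p. \<bar>\<theta> l\<bar>) ^ Suc N" .
    moreover have "integrable M (D (Suc N) k)"
      using int by (subst integrable_cong_AE[OF _ _ eq]) auto
    ultimately show ?case by blast
  qed
  then show ?thesis using that[of C] by (simp add: D_def[abs_def])
qed

lemma ar_filter_tendsto:
  assumes "(\<Sum>l=1..p. \<bar>\<theta> l\<bar>) < 1"
  shows "AE \<omega> in M. (\<lambda>N. ar_filter p \<theta> N k (\<lambda>j. w j \<omega>)) \<longlonglongrightarrow> x k \<omega>"
proof -
  obtain C where C: "\<And>N k. integrable M (\<lambda>\<omega>. x k \<omega> - ar_filter p \<theta> N k (\<lambda>j. w j \<omega>))"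
    "\<And>N k. expectation (\<lambda>\<omega>. \<bar>x k \<omega> - ar_filter p \<theta> N k (\<lambda>j. w j \<omega>)\<bar>) \<le> C * (\<Sum>l=1..p. \<bar>\<theta> l\<bar>) ^ N"
    using ar_filter_L1_error by blast
  have "AE \<omega> in M. (\<lambda>N. x k \<omega> - ar_filter p \<theta> N k (\<lambda>j. w j \<omega>)) \<longlonglongrightarrow> 0"
    by (rule AE_tendsto_0_of_geometric[OF C]) (use assms in \<open>auto intro: sum_nonneg\<close>)
  then show ?thesis
  proof eventually_elim
    case (elim \<omega>)
    from tendsto_diff[OF tendsto_const[of "x k \<omega>"] elim] show ?case by simp
  qed
qed

text \<open>The joint law of i.i.d. variables is a product of equal factors, which the injective
  reindexing by a translation preserves.\<close>

lemma distr_innovations_shift: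
  "distr M (\<Pi>\<^sub>M j\<in>UNIV. borel) (\<lambda>\<omega> j. w (j + h) \<omega>) = distr M (\<Pi>\<^sub>M j\<in>UNIV. borel) (\<lambda>\<omega> j. w j \<omega>)"
proof -
  define S :: "(int \<Rightarrow> real) measure" where "S = (\<Pi>\<^sub>M j\<in>UNIV. borel)"
  define D where "D = distr M borel (w 0)"
  define P where "P = (\<Pi>\<^sub>M j\<in>(UNIV :: int set). D)"
  have sets: "sets P = sets S"
    unfolding P_def S_def by (rule sets_PiM_cong) (auto simp: D_def)
  have W: "(\<lambda>\<omega> j. w j \<omega>) \<in> measurable M S"
    unfolding S_def by (rule measurable_PiM_single') auto
  have sh: "(\<lambda>u j. u (j + h)) \<in> measurable S S"
    unfolding S_def by (rule measurable_PiM_single') (auto intro: measurable_component_singleton)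
  have "distr M borel (w j) = D" for j
    unfolding D_def by (rule innovations_ident)
  then have law: "distr M S (\<lambda>\<omega> j. w j \<omega>) = P"
    using innovations_indep
    by (subst (asm) indep_vars_iff_distr_eq_PiM) (auto simp: S_def P_def restrict_UNIV)
  have "distr P P (\<lambda>u j. u (j + h)) = P"
    using distr_PiM_reindex[of UNIV "\<lambda>_. D" "\<lambda>j. j + h" UNIV]
    by (simp add: P_def D_def prob_space_distr inj_on_def restrict_UNIV)
  then have "distr (distr M S (\<lambda>\<omega> j. w j \<omega>)) S (\<lambda>u j. u (j + h)) = P"
    unfolding law using distr_cong[OF refl sets[symmetric] refl, of P "\<lambda>u j. u (j + h)"] by simp
  also have "distr (distr M S (\<lambda>\<omega> j. w j \<omega>)) S (\<lambda>u j. u (j + h)) = distr M S (\<lambda>\<omega> j. w (j + h) \<omega>)"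
    by (simp add: distr_distr[OF sh W] comp_def)
  finally show ?thesis using law by (simp add: S_def)
qed

text \<open>Almost surely the path is \<open>G\<close> of the innovations, simultaneously at the
  countably many times. Since \<open>G\<close> commutes with shifts, the law of the shifted path is
  the image under \<open>G\<close> of the law of the shifted innovations.\<close>

lemma strictly_stationary:
  assumes "(\<Sum>l=1..p. \<bar>\<theta> l\<bar>) < 1"
  shows "distr M (\<Pi>\<^sub>M k\<in>UNIV. borel) (\<lambda>\<omega> k. x (k + h) \<omega>) = distr M (\<Pi>\<^sub>M k\<in>UNIV. borel) (\<lambda>\<omega> k. x k \<omega>)"
proof -
  define S :: "(int \<Rightarrow> real) measure" where "S = (\<Pi>\<^sub>M j\<in>UNIV. borel)"
  \<comment> \<open>Where the filters diverge, \<open>lim\<close> has an unspecified value; this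
    concerns only a null set of innovation paths.\<close>
  define G where "G u = (\<lambda>k. lim (\<lambda>N. ar_filter p \<theta> N k u))" for u
  have G: "G \<in> measurable S S"
    unfolding S_def G_def[abs_def] by (rule measurable_PiM_single') auto
  have W: "(\<lambda>\<omega> j. w (j + h) \<omega>) \<in> measurable M S" for h
    unfolding S_def by (rule measurable_PiM_single') auto
  have X: "(\<lambda>\<omega> j. x (j + h) \<omega>) \<in> measurable M S" for h
    unfolding S_def by (rule measurable_PiM_single') auto
  have "AE \<omega> in M. \<forall>k. (\<lambda>N. ar_filter p \<theta> N k (\<lambda>j. w j \<omega>)) \<longlonglongrightarrow> x k \<omega>"
    unfolding AE_all_countable using ar_filter_tendsto[OF assms] by blast
  then have ae: "AE \<omega> in M. (\<lambda>k. x (k + h) \<omega>) = G (\<lambda>j. w (j + h) \<omega>)" for h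
  proof eventually_elim
    case (elim \<omega>)
    have "lim (\<lambda>N. ar_filter p \<theta> N k (\<lambda>j. w (j + h) \<omega>)) = x (k + h) \<omega>" for k
      using elim[rule_format, of "k + h"] by (intro limI) (simp add: ar_filter_shift)
    then show ?case by (simp add: G_def)
  qed
  have "distr M S (\<lambda>\<omega> k. x (k + h) \<omega>) = distr (distr M S (\<lambda>\<omega> j. w (j + h) \<omega>)) S G" for h
  proof -
    have "distr M S (\<lambda>\<omega> k. x (k + h) \<omega>) = distr M S (\<lambda>\<omega>. G (\<lambda>j. w (j + h) \<omega>))"
      using ae X measurable_compose[OF W G] by (intro distr_cong_AE refl) auto
    then show ?thesis by (simp add: distr_distr[OF G W] comp_def)
  qed
  from this[of h] this[of 0] show ?thesis
    by (simp add: distr_innovations_shift flip: S_def) (simp add: S_def distr_innovations_shift)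
qed

text \<open>This extends the concentration inequality from the window starting at time 1 to any
  other window. The deviation event is determined by the path, whose law is shift invariant.\<close>

lemma prob_biased_autocorr_shift:
  assumes "(\<Sum>l=1..p. \<bar>\<theta> l\<bar>) < 1"
  shows "prob {\<omega> \<in> space M. t < \<bar>biased_autocorr (\<lambda>k. x (k + h)) n d \<omega> - c\<bar>} =
    prob {\<omega> \<in> space M. t < \<bar>biased_autocorr x n d \<omega> - c\<bar>}"
proof -
  define S :: "(int \<Rightarrow> real) measure" where "S = (\<Pi>\<^sub>M j\<in>UNIV. borel)"
  \<comment> \<open>With the coordinate maps as process, the biased autocorrelation becomes a
    function on path space.\<close>
  define B where "B = {v \<in> space S. t < \<bar>biased_autocorr (\<lambda>k v. v k) n d v - c\<bar>}"
  have [measurable]: "(\<lambda>v. v k) \<in> borel_measurable S" for k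
    unfolding S_def by (rule measurable_component_singleton) simp
  have "B \<in> sets S"
    unfolding B_def biased_autocorr_def by measurable
  moreover have "(\<lambda>\<omega> j. x (j + h) \<omega>) \<in> measurable M S" for h
    unfolding S_def by (rule measurable_PiM_single') auto
  ultimately have "measure (distr M S (\<lambda>\<omega> k. x (k + h) \<omega>)) B =
      prob {\<omega> \<in> space M. t < \<bar>biased_autocorr (\<lambda>k. x (k + h)) n d \<omega> - c\<bar>}" for h
    by (subst measure_distr)
       (auto simp: B_def S_def space_PiM biased_autocorr_def intro!: arg_cong[where f = prob])
  from this[of h] this[of 0] show ?thesis
    by (simp add: S_def strictly_stationary[OF assms])
qed

lemma expectation_biased_autocorr:
  "expectation (biased_autocorr x n d) = real n / real (n + d) * autocorr M x (int d)"
  unfolding biased_autocorr_def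
  by (simp add: integrable_x_mult_x expectation_x_mult_x)

text \<open>The form is the second moment of a linear combination of the process.\<close>

lemma covariance_quad_form_nonneg:
  fixes u :: "nat \<Rightarrow> real"
  shows "0 \<le> (\<Sum>i<n. \<Sum>j<n. u i * u j * autocorr M x \<bar>int i - int j\<bar>)"
proof -
  have "(\<Sum>i<n. \<Sum>j<n. u i * u j * autocorr M x \<bar>int i - int j\<bar>) =
      expectation (\<lambda>\<omega>. \<Sum>i<n. \<Sum>j<n. u i * u j * (x (int i) \<omega> * x (int j) \<omega>))"
    by (simp add: integrable_x_mult_x expectation_x_mult_x)
  also have "\<dots> = expectation (\<lambda>\<omega>. (\<Sum>i<n. u i * x (int i) \<omega>)\<^sup>2)"
    by (simp add: power2_eq_square sum_product mult_ac)
  also have "\<dots> \<ge> 0" by simp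
  finally show ?thesis .
qed

end

subsection \<open>Concentration of the Gram matrix\<close>

text \<open>The covariance matrix is positive semidefinite, so its singular values control its form;
  extension by zero then restricts the bound to \<open>S\<close>.\<close>

lemma covariance_quad_form_ge:
  assumes "ar_process M q \<theta> \<sigma> w x"
    and sv: "singular_values (covariance_mat M x p) \<subseteq> {l..}" and l: "0 < l" and S: "S \<subseteq> {..<p}"
  shows "l * (\<Sum>i\<in>S. (u i)\<^sup>2) \<le> quad_form S (\<lambda>i j. autocorr M x \<bar>int i - int j\<bar>) u"
proof (cases "p = 0")
  case True
  then show ?thesis using S by (simp add: quad_form_def)
next
  case False
  interpret ar_process M q \<theta> \<sigma> w x by fact
  let ?R = "covariance_mat M x p"
  let ?r = "\<lambda>i j. autocorr M x \<bar>int i - int j\<bar>"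
  have R: "?R \<in> carrier_mat p p" by (simp add: covariance_mat_def)
  have iff: "(\<forall>v\<in>carrier_vec p. a * (v \<bullet> v) \<le> v \<bullet> (?R *\<^sub>v v)) \<longleftrightarrow>
      (\<forall>u. a * (\<Sum>i<p. (u i)\<^sup>2) \<le> quad_form {..<p} ?r u)" for a
    by (rule all_carrier_vec_quad_form_iff[OF R bij_betw_id]) (simp add: covariance_mat_def)
  have sym: "transpose_mat ?R = ?R"
    by (intro eq_matI) (auto simp: covariance_mat_def abs_minus_commute)
  have "\<forall>v\<in>carrier_vec p. 0 * (v \<bullet> v) \<le> v \<bullet> (?R *\<^sub>v v)"
    unfolding iff using covariance_quad_form_nonneg[where n = p] by (simp add: quad_form_def)
  then have "\<forall>v\<in>carrier_vec p. l * (v \<bullet> v) \<le> v \<bullet> (?R *\<^sub>v v)"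
    using singular_values_ge_iff[OF R sym _ _ l] False sv by auto
  then have "l * (\<Sum>i<p. (u i)\<^sup>2) \<le> quad_form {..<p} ?r u" for u
    by (simp add: iff)
  from this[of "\<lambda>i. if i \<in> S then u i else 0"] S show ?thesis
    by (simp add: quad_form_mono_neutral if_distrib[where f = "\<lambda>y. y\<^sup>2"] sum.If_cases Int_absorb1
        cong: if_cong)
qed

text \<open>Two columns are windows of the process at lag \<open>d\<close>. Read from the last row
  upwards, their products are those of a shifted biased autocorrelation, which differs only in
  dividing by \<open>n + d\<close> instead of \<open>n\<close>.\<close>

lemma gram_covariates:
  assumes "j < p" "k < p" "1 \<le> n"
  defines "d \<equiv> nat \<bar>int j - int k\<bar>"
  shows "gram (covariates x n p \<omega>) j k =
    real (n + d) / real n * biased_autocorr (\<lambda>i. x (i + (- int (max j k) - 1))) n d \<omega>"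
proof -
  \<comment> \<open>The last row holds the times \<open>- j\<close> and \<open>- k\<close>; the
    earlier one must be the time \<open>1 + h\<close> of the first summand.\<close>
  define h where "h = - int (max j k) - 1"
  define g where "g i = x (int (Suc i) + h) \<omega> * x (int (Suc i) + h + int d) \<omega>" for i
  have "(\<Sum>r<n. x (int n - int r - int j - 1) \<omega> * x (int n - int r - int k - 1) \<omega>) =
      (\<Sum>r<n. g (n - Suc r))"
  proof (rule sum.cong[OF refl])
    fix r assume "r \<in> {..<n}"
    then have "int (Suc (n - Suc r)) = int n - int r" by simp
    then show "x (int n - int r - int j - 1) \<omega> * x (int n - int r - int k - 1) \<omega> = g (n - Suc r)"
      unfolding g_def h_def d_def by (cases "j \<le> k") (simp_all add: algebra_simps)
  qed
  also have "\<dots> = (\<Sum>i<n. g i)" by (rule sum.nat_diff_reindex)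
  also have "\<dots> = (\<Sum>i=1..n. x (int i + h) \<omega> * x (int i + int d + h) \<omega>)"
    unfolding g_def by (simp add: sum.atLeast1_atMost_eq algebra_simps)
  finally show ?thesis
    using assms(1-3) by (simp add: gram_def covariates_def biased_autocorr_def h_def)
qed

text \<open>Multiplying numerator and denominator by \<open>N\<close> gives z^2 / (c N + z^(3/2));
  dividing both by z^(3/2) leaves \<open>N\<close> in one place only, so the exponent is visibly
  decreasing in \<open>N\<close>.\<close>

lemma bernstein_exponent_scaling:
  fixes z N c :: real
  assumes "0 < z" "0 < N" "0 \<le> c"
  shows "(z / N)\<^sup>2 * N / (c + (z / N) powr (3/2) * sqrt N) = sqrt z / (1 + c * N / z powr (3/2))"
proof -
  have powr: "y powr (3/2) = y * sqrt y" if "0 < y" for y :: real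
    using that powr_add[of y 1 "1/2"] by (simp add: powr_half_sqrt)
  have "(z / N) powr (3/2) * sqrt N = z * sqrt z / N"
    using assms by (simp add: powr real_sqrt_divide)
  then have "(z / N)\<^sup>2 * N / (c + (z / N) powr (3/2) * sqrt N) = z\<^sup>2 / (c * N + z * sqrt z)"
    using assms by (simp add: field_simps power2_eq_square)
  also have "\<dots> = (z * sqrt z) * sqrt z / ((z * sqrt z) * (1 + c * N / (z * sqrt z)))"
    using assms by (simp add: power2_eq_square distrib_left mult_ac add.commute)
  also have "\<dots> = sqrt z / (1 + c * N / (z * sqrt z))"
    using assms by simp
  finally show ?thesis using assms by (simp add: powr)
qed

text \<open>The bound obtained for an entry depends on its lag through \<open>n + d\<close>;
  weakening this to \<open>n + p\<close> makes it uniform over the entries, as the union bound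
  requires.\<close>

lemma gram_entry_concentration:
  fixes a y :: real
  assumes ar: "ar_process M p \<theta> \<sigma> w x" and \<sigma>: "0 < \<sigma>" and \<theta>: "(\<Sum>l=1..p. \<bar>\<theta> l\<bar>) < 1"
    and conc: "autocorr_concentration M x p \<sigma> c1 c2 c3" and c: "0 < c1" "0 < c2" "0 < c3"
    and n: "1 \<le> n" and jk: "j < p" "k < p" and a: "0 < a" and s: "0 < s"
  shows "measure M {\<omega> \<in> space M. a / s < \<bar>gram (covariates x n p \<omega>) j k - autocorr M x \<bar>int j - int k\<bar>\<bar>}
    \<le> c1 * real (n + p) * exp (- (c2 / \<sigma> * (sqrt (a * (real n / s)) /
        (1 + c3 * \<sigma> ^ 3 * real (n + p) / (a * (real n / s)) powr (3/2)))))"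
proof -
  interpret ar_process M p \<theta> \<sigma> w x by fact
  define d where "d = nat \<bar>int j - int k\<bar>"
  define h where "h = - int (max j k) - 1"
  define z where "z = a * (real n / s)"
  define N where "N = real (n + d)"
  \<comment> \<open>The Gram entry is \<open>N / n\<close> times a biased autocorrelation, so the
    threshold \<open>a / s\<close> becomes \<open>(n / N) * (a / s) = z / N\<close>.\<close>
  define t where "t = z / N"
  define c where "c = c3 * \<sigma> ^ 3"
  define P where "P = real (n + p)"
  define E where "E Q = c2 / \<sigma> * (sqrt z / (1 + c * Q / z powr (3/2)))" for Q
  have d: "d < p" using jk by (auto simp: d_def)
  have pos: "0 < z" "0 < N" "0 < t" "0 < c" using n a s \<sigma> \<open>0 < c3\<close> by (simp_all add: z_def N_def t_def c_def)
  have NP: "N \<le> P" using d by (simp add: N_def P_def)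
  then have "0 < P" using pos(2) by simp
  \<comment> \<open>The same factor removes the bias: the bracket is the mean of the biased
    autocorrelation.\<close>
  have r: "autocorr M x \<bar>int j - int k\<bar> = N / real n * (real n / N * autocorr M x (int d))"
    using n pos(2) by (simp add: d_def)
  have "a / s < \<bar>gram (covariates x n p \<omega>) j k - autocorr M x \<bar>int j - int k\<bar>\<bar> \<longleftrightarrow>
      t < \<bar>biased_autocorr (\<lambda>k. x (k + h)) n d \<omega> - expectation (biased_autocorr x n d)\<bar>" for \<omega>
  proof -
    have "gram (covariates x n p \<omega>) j k - autocorr M x \<bar>int j - int k\<bar> =
        N / real n * (biased_autocorr (\<lambda>k. x (k + h)) n d \<omega> - expectation (biased_autocorr x n d))"
      unfolding r gram_covariates[OF jk n] expectation_biased_autocorr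
      by (simp only: N_def d_def h_def right_diff_distrib)
    moreover have "a / s = N / real n * t"
      using n pos by (simp add: t_def z_def)
    moreover have "0 < N / real n" using n pos by simp
    ultimately show ?thesis by (simp only: abs_mult abs_of_pos mult_less_cancel_left_pos)
  qed
  then have "measure M {\<omega> \<in> space M. a / s < \<bar>gram (covariates x n p \<omega>) j k - autocorr M x \<bar>int j - int k\<bar>\<bar>}
      = prob {\<omega> \<in> space M. t < \<bar>biased_autocorr x n d \<omega> - expectation (biased_autocorr x n d)\<bar>}"
    by (simp add: prob_biased_autocorr_shift[OF \<theta>])
  also have "\<dots> \<le> c1 * N * exp (- (c2 / \<sigma> * (t\<^sup>2 * N / (c + t powr (3/2) * sqrt N))))"
    using conc n d pos(3) unfolding autocorr_concentration_def N_def c_def by blast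
  also have "c2 / \<sigma> * (t\<^sup>2 * N / (c + t powr (3/2) * sqrt N)) = E N"
    unfolding t_def E_def using pos by (simp add: bernstein_exponent_scaling)
  \<comment> \<open>Replacing \<open>N\<close> by the larger \<open>P\<close> increases the
    prefactor and decreases \<open>E\<close>, so both factors grow.\<close>
  also have "c1 * N * exp (- E N) \<le> c1 * P * exp (- E P)"
  proof -
    have "1 + c * N / z powr (3/2) \<le> 1 + c * P / z powr (3/2)"
      using pos NP by (intro add_left_mono divide_right_mono mult_left_mono) auto
    then have "E P \<le> E N"
      unfolding E_def using pos \<open>0 < P\<close> \<sigma> \<open>0 < c2\<close>
      by (intro mult_left_mono divide_left_mono mult_pos_pos add_pos_nonneg) auto
    then show ?thesis
      using \<open>0 < c1\<close> NP pos by (intro mult_mono) auto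
  qed
  finally show ?thesis by (simp add: E_def P_def z_def c_def)
qed

lemma RE_condition_of_close:
  assumes ar: "ar_process M p \<theta> \<sigma> w x"
    and sv: "singular_values (covariance_mat M x p) \<subseteq> {l..}" and l: "0 < l"
    and q: "1 \<le> q" "q \<le> p"
    and close: "\<And>j k. j < p \<Longrightarrow> k < p \<Longrightarrow>
      \<bar>gram (covariates x n p \<omega>) j k - autocorr M x \<bar>int j - int k\<bar>\<bar> \<le> l / (2 * real q)"
  shows "RE_condition (covariates x n p \<omega>) q (l / 2)"
proof -
  let ?X = "covariates x n p \<omega>"
  have dim: "dim_col ?X = p" by (simp add: covariates_def)
  have "l / 2 * (\<Sum>i\<in>S. (u i)\<^sup>2) \<le> quad_form S (gram ?X) u" if S: "S \<subseteq> {..<p}" "card S = q" for S u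
  proof -
    have "(l - l / (2 * real q) * real (card S)) * (\<Sum>i\<in>S. (u i)\<^sup>2) \<le> quad_form S (gram ?X) u"
      by (rule quad_form_perturb[OF close covariance_quad_form_ge[OF ar sv l S(1)]]) (use S(1) l in auto)
    \<comment> \<open>Since \<open>card S = q\<close>, the perturbation costs exactly
      \<open>l / 2\<close>.\<close>
    then show ?thesis using S(2) q by (simp add: field_simps)
  qed
  then show ?thesis using q l dim by (subst RE_condition_iff) auto
qed

theorem lemma4:
  fixes M :: "'a measure" and w x :: "int \<Rightarrow> 'a \<Rightarrow> real" and \<theta> :: "nat \<Rightarrow> real"
    and p n m s :: nat and \<sigma> \<eta> lmin lmax c1 c2 c3 c4 c5 :: real
  assumes "ar_process M p \<theta> \<sigma> w x"
    and "\<sigma> > 0"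
    and "(\<Sum>l=1..p. \<bar>\<theta> l\<bar>) \<le> 1 - \<eta>" and "1 - \<eta> < 1"
    and "singular_values (covariance_mat M x p) \<subseteq> {lmin..lmax}" and "lmin > 0"
    and "c1 > 0" and "c2 > 0" and "c3 > 0"
    and "autocorr_concentration M x p \<sigma> c1 c2 c3"
    and "n \<ge> 1" and "m \<ge> 1" and "s \<ge> 1" and "(m + 1) * s \<le> p"
    and "c4 = c2 / \<sigma> * sqrt (lmin / (2 * (real m + 1)))"
    and "c5 = c3 * \<sigma> ^ 3 / (lmin / (2 * (real m + 1))) powr (3 / 2)"
  shows "measure M {\<omega> \<in> space M. RE_condition (covariates x n p \<omega>) ((m + 1) * s) (lmin / 2)}
    \<ge> 1 - c1 * (real p)\<^sup>2 * real (n + p) *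
          exp (- (c4 * sqrt (real n / real s) /
                  (1 + c5 * (real (n + p) / (real n / real s) powr (3 / 2)))))"
proof -
  interpret ar_process M p \<theta> \<sigma> w x by fact
  define a where "a = lmin / (2 * (real m + 1))"
  define q where "q = (m + 1) * s"
  define y where "y = real n / real s"
  define \<epsilon> where "\<epsilon> = c4 * sqrt y / (1 + c5 * (real (n + p) / y powr (3 / 2)))"
  have c4: "c4 = c2 / \<sigma> * sqrt a" and c5: "c5 = c3 * \<sigma> ^ 3 / a powr (3 / 2)"
    using assms(15,16) by (simp_all only: a_def)
  have pos: "0 < a" "0 < y" using assms by (simp_all add: a_def y_def)
  have q: "1 \<le> q" "q \<le> p" using assms by (simp_all add: q_def)
  \<comment> \<open>This splits the tolerance \<open>lmin / (2 q)\<close> into \<open>a\<close>, the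
    quantity inside \<open>c4\<close> and \<open>c5\<close>, and the factor \<open>1 / s\<close>
    that yields the ratio \<open>n / s\<close>.\<close>
  have "2 * real q = 2 * (real m + 1) * real s" by (simp add: q_def algebra_simps)
  then have lq: "lmin / (2 * real q) = a / real s" by (simp add: a_def)
  define B where "B j k = {\<omega> \<in> space M. a / real s <
      \<bar>gram (covariates x n p \<omega>) j k - autocorr M x \<bar>int j - int k\<bar>\<bar>}" for j k
  define RE where "RE = {\<omega> \<in> space M. RE_condition (covariates x n p \<omega>) q (lmin / 2)}"
  have X: "covariates x n p \<omega> \<in> carrier_mat n p" for \<omega> by (simp add: covariates_def)
  have X_meas: "(\<lambda>\<omega>. covariates x n p \<omega> $$ (i, j)) \<in> borel_measurable M" if "i < n" "j < p" for i j
    using that by (simp add: covariates_def)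
  have RE_meas: "RE \<in> events"
    unfolding RE_def using assms(6) q by (intro measurable_RE_condition[OF X X_meas]) auto
  have B_meas: "B j k \<in> events" if "j < p" "k < p" for j k
  proof -
    have "(\<lambda>\<omega>. gram (covariates x n p \<omega>) j k) \<in> borel_measurable M"
      by (rule borel_measurable_gram[OF X X_meas that])
    then show ?thesis unfolding B_def by measurable
  qed
  have B_bound: "prob (B j k) \<le> c1 * real (n + p) * exp (- \<epsilon>)" if "j < p" "k < p" for j k
  proof -
    have "prob (B j k) \<le> c1 * real (n + p) * exp (- (c2 / \<sigma> * (sqrt (a * y) /
        (1 + c3 * \<sigma> ^ 3 * real (n + p) / (a * y) powr (3/2)))))"
      unfolding B_def y_def using that assms pos by (intro gram_entry_concentration) auto
    \<comment> \<open>The square root and the power 3/2 are multiplicative, so the powers of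
      \<open>a\<close> are absorbed into \<open>c4\<close> and \<open>c5\<close>.\<close>
    also have "c2 / \<sigma> * (sqrt (a * y) / (1 + c3 * \<sigma> ^ 3 * real (n + p) / (a * y) powr (3/2))) = \<epsilon>"
      using pos by (simp add: \<epsilon>_def c4 c5 real_sqrt_mult powr_mult)
    finally show ?thesis .
  qed
  \<comment> \<open>Failure of the condition forces some entry to deviate by more than the
    tolerance.\<close>
  have "space M - RE \<subseteq> (\<Union>(j, k)\<in>{..<p} \<times> {..<p}. B j k)"
  proof
    fix \<omega> assume \<omega>: "\<omega> \<in> space M - RE"
    show "\<omega> \<in> (\<Union>(j, k)\<in>{..<p} \<times> {..<p}. B j k)"
    proof (rule ccontr)
      assume "\<not> ?thesis"
      then have "\<bar>gram (covariates x n p \<omega>) j k - autocorr M x \<bar>int j - int k\<bar>\<bar> \<le> lmin / (2 * real q)"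
        if "j < p" "k < p" for j k
        using that \<omega> by (force simp: B_def lq not_less)
      then have "RE_condition (covariates x n p \<omega>) q (lmin / 2)"
        using assms(5,6) q by (intro RE_condition_of_close[OF assms(1)]) auto
      then show False using \<omega> by (simp add: RE_def)
    qed
  qed
  then have "prob (space M - RE) \<le> prob (\<Union>(j, k)\<in>{..<p} \<times> {..<p}. B j k)"
    using B_meas by (intro finite_measure_mono sets.finite_UN) auto
  also have "\<dots> \<le> (\<Sum>(j, k)\<in>{..<p} \<times> {..<p}. prob (B j k))"
    unfolding case_prod_unfold by (intro finite_measure_subadditive_finite) (use B_meas in auto)
  also have "\<dots> \<le> (\<Sum>(j, k)\<in>{..<p} \<times> {..<p}. c1 * real (n + p) * exp (- \<epsilon>))"
    by (rule sum_mono) (use B_bound in auto)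
  also have "\<dots> = c1 * (real p)\<^sup>2 * real (n + p) * exp (- \<epsilon>)"
    by (simp add: power2_eq_square case_prod_unfold)
  finally have "1 - prob RE \<le> c1 * (real p)\<^sup>2 * real (n + p) * exp (- \<epsilon>)"
    by (simp add: prob_compl[OF RE_meas])
  then show ?thesis by (simp add: RE_def q_def \<epsilon>_def y_def)
qed

end
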